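(* Let $0 < \delta < \rho \leq 1$. The algorithm rAdaptiveCoinTester (specified in full in the context) is a $\rho$-replicable algorithm solving the $(p_0, q_0)$-coin problem with expected sample complexity $O\left(\frac{q_0 \log(1/\delta)}{(q_0 - p_0)^2 \rho}\right)$ and worst-case sample complexity $O\left(\frac{q_0 \log(1/\delta)}{(q_0 - p_0)^2 \rho^2}\right)$.
   Context: Coin problem: let $0\le p_0<q_0\le 1$ and $\delta<\frac12$. An algorithm $\mathcal{A}$ (with internal randomness $r$) is given i.i.d. flips of a coin with unknown bias $p\in[0,1]$ (samples from $\mathcal{D}=\mathrm{Bern}(p)$) and outputs ACCEPT or REJECT. It solves the $(p_0,q_0)$-coin problem if (1) whenever $p \le p_0$, $\Pr_{S,r}(\mathcal{A}(S;r)=\text{ACCEPT})<\delta$; and (2) whenever $p\ge q_0$, $\Pr_{S,r}(\mathcal{A}(S;r)=\text{REJECT})<\delta$. Here $S$ denotes the samples drawn. Replicability: $\mathcal{A}$ is $\rho$-replicable if for every input distribution $\mathcal{D}$ (here $\mathrm{Bern}(p)$ for every $p\in[0,1]$), $\Pr_{r,S,S'}(\mathcal{A}(S;r)=\mathcal{A}(S';r))\ge 1-\rho$, where $S,S'$ are independent sets of i.i.d. samples from $\mathcal{D}$ and the internal randomness $r$ is shared between the two runs. The algorithm rAdaptiveCoinTester, with inputs $p_0<q_0$, $\rho$, $\delta$ and sample access to $\mathcal{D}=\mathrm{Bern}(p)$, is as follows. Set $\delta\leftarrow\min(\delta,\rho/4)$ and $b\leftarrow\frac{\rho(q_0-p_0)}{16}$,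 and draw a random threshold $r$ uniformly from $[p_0+b,\,q_0-b]$ (this is its internal randomness). For $t=1,\dots,T$, where $T=4+\log_2\frac1\rho$: - let $\varepsilon_t=\frac{q_0-p_0}{2^{t+2}}$ and $m_t=\frac{3q_0}{\varepsilon_t^2}\log\frac{2T}{\delta}$; - draw a fresh sample $b_1,\dots,b_{m_t}$ of size $m_t$ from $\mathcal{D}$ and let $\hat p_t=\frac1{m_t}\sum_{i=1}^{m_t}b_i$, $\hat b_t^-=\hat p_t-\varepsilon_t$, $\hat b_t^+=\hat p_t+\varepsilon_t$; - if $\min(|\hat b_t^- - r|,|\hat b_t^+ - r|)>\varepsilon_t$, then stop, returning ACCEPT if $\hat p_t>r$ and REJECT if $\hat p_t\le r$. If no iteration returned, return REJECT. (Integrality of $T$ and $m_t$ is ignored.) The expected sample complexity is the expected number of samples drawn (over samples and internal randomness, for any bias $p$); the worst-case sample complexity is the maximum number ever drawn. *)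

theory Defs
  imports "HOL-Probability.Probability"
begin

datatype verdict = Accept | Reject

text \<open>
  The algorithm reads flips \<open>S 0, S 1, \<dots>\<close> of the coin in order. Its internal randomness is a seed
  drawn from a probability space \<open>R\<close>. A run \<open>A S r\<close> on flips \<open>S\<close> with seed \<open>r\<close> yields the verdict
  together with the number of flips that were drawn.
\<close>

type_synonym 'r coin_algorithm = "(nat \<Rightarrow> bool) \<Rightarrow> 'r \<Rightarrow> verdict \<times> nat"

definition coin_flips :: "real \<Rightarrow> (nat \<Rightarrow> bool) measure" where
  "coin_flips p = Pi\<^sub>M UNIV (\<lambda>_. measure_pmf (bernoulli_pmf p))"

text \<open>
  Measurability makes the probabilities and expectations below meaningful; the sigma-algebra of
  \<open>coin_flips p\<close> does not depend on the bias.
\<close>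

definition randomized_coin_algorithm :: "'r measure \<Rightarrow> 'r coin_algorithm \<Rightarrow> bool" where
  "randomized_coin_algorithm R A \<longleftrightarrow>
     prob_space R \<and>
     (\<lambda>(S, r). A S r) \<in>
       measurable (Pi\<^sub>M UNIV (\<lambda>_. count_space UNIV) \<Otimes>\<^sub>M R) (count_space UNIV)"

definition verdict_prob :: "'r measure \<Rightarrow> 'r coin_algorithm \<Rightarrow> real \<Rightarrow> verdict \<Rightarrow> real" where
  "verdict_prob R A p v =
     measure (coin_flips p \<Otimes>\<^sub>M R) {(S, r) \<in> space (coin_flips p \<Otimes>\<^sub>M R). fst (A S r) = v}"

definition solves_coin_problem ::
    "real \<Rightarrow> real \<Rightarrow> real \<Rightarrow> 'r measure \<Rightarrow> 'r coin_algorithm \<Rightarrow> bool" where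
  "solves_coin_problem p0 q0 \<delta> R A \<longleftrightarrow>
     (\<forall>p\<in>{0..1}.
        (p \<le> p0 \<longrightarrow> verdict_prob R A p Accept < \<delta>) \<and>
        (p \<ge> q0 \<longrightarrow> verdict_prob R A p Reject < \<delta>))"

definition replicable :: "real \<Rightarrow> 'r measure \<Rightarrow> 'r coin_algorithm \<Rightarrow> bool" where
  "replicable \<rho> R A \<longleftrightarrow>
     (\<forall>p\<in>{0..1}.
        measure (R \<Otimes>\<^sub>M coin_flips p \<Otimes>\<^sub>M coin_flips p)
          {(r, S, S') \<in> space (R \<Otimes>\<^sub>M coin_flips p \<Otimes>\<^sub>M coin_flips p).
             fst (A S r) = fst (A S' r)} \<ge> 1 - \<rho>)"

definition expected_samples :: "'r measure \<Rightarrow> 'r coin_algorithm \<Rightarrow> real \<Rightarrow> ennreal" where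
  "expected_samples R A p = (\<integral>\<^sup>+ (S, r). of_nat (snd (A S r)) \<partial>(coin_flips p \<Otimes>\<^sub>M R))"

definition worst_case_samples :: "'r measure \<Rightarrow> 'r coin_algorithm \<Rightarrow> ennreal" where
  "worst_case_samples R A = (SUP (S, r)\<in>UNIV \<times> space R. of_nat (snd (A S r)))"


text \<open>
  The number of iterations and the batch sizes are rounded up to integers; \<open>m\<^sub>t\<close> is computed from
  the rounded number of iterations. The unlabelled logarithm is taken to be natural.
\<close>

definition num_iterations :: "real \<Rightarrow> nat" where
  "num_iterations \<rho> = nat \<lceil>4 + log 2 (1 / \<rho>)\<rceil>"

definition accuracy :: "real \<Rightarrow> real \<Rightarrow> nat \<Rightarrow> real" where
  "accuracy p0 q0 t = (q0 - p0) / 2 ^ (t + 2)"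

definition batch_size :: "real \<Rightarrow> real \<Rightarrow> nat \<Rightarrow> real \<Rightarrow> nat \<Rightarrow> nat" where
  "batch_size p0 q0 T \<delta> t = nat \<lceil>3 * q0 / (accuracy p0 q0 t)\<^sup>2 * ln (2 * real T / \<delta>)\<rceil>"

text \<open>
  \<open>tester_loop p0 q0 T \<delta> S r k t n\<close> performs the iterations \<open>t, \<dots>, t + k - 1\<close>, where \<open>n\<close> flips have
  been drawn before iteration \<open>t\<close>, so that the fresh sample consists of the flips from position \<open>n\<close> on.
\<close>

primrec tester_loop ::
    "real \<Rightarrow> real \<Rightarrow> nat \<Rightarrow> real \<Rightarrow> (nat \<Rightarrow> bool) \<Rightarrow> real \<Rightarrow> nat \<Rightarrow> nat \<Rightarrow> nat \<Rightarrow> verdict \<times> nat" where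
  "tester_loop p0 q0 T \<delta> S r 0 t n = (Reject, n)"
| "tester_loop p0 q0 T \<delta> S r (Suc k) t n =
     (let \<epsilon> = accuracy p0 q0 t;
          m = batch_size p0 q0 T \<delta> t;
          p_hat = (\<Sum>i<m. of_bool (S (n + i))) / real m;
          b_minus = p_hat - \<epsilon>;
          b_plus = p_hat + \<epsilon>
      in if min \<bar>b_minus - r\<bar> \<bar>b_plus - r\<bar> > \<epsilon>
         then (if p_hat > r then Accept else Reject, n + m)
         else tester_loop p0 q0 T \<delta> S r k (Suc t) (n + m))"

definition rAdaptiveCoinTester :: "real \<Rightarrow> real \<Rightarrow> real \<Rightarrow> real \<Rightarrow> real coin_algorithm" where
  "rAdaptiveCoinTester p0 q0 \<rho> \<delta> S r =
     (let \<delta>' = min \<delta> (\<rho> / 4);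
          T = num_iterations \<rho>
      in tester_loop p0 q0 T \<delta>' S r T 1 0)"

text \<open>
  The threshold is uniform on an interval. The space is restricted to that interval so that
  \<open>worst_case_samples\<close> ranges over actual thresholds only.
\<close>

definition threshold_measure :: "real \<Rightarrow> real \<Rightarrow> real \<Rightarrow> real measure" where
  "threshold_measure p0 q0 \<rho> =
     (let b = \<rho> * (q0 - p0) / 16;
          I = {p0 + b .. q0 - b}
      in uniform_measure (restrict_space lborel I) I)"

end

theory Submission
  imports Defs
begin

text \<open>
  An iteration stops iff the empirical mean \<open>x\<close> of its batch satisfies \<open>\<bar>x - r\<bar> > 2 \<epsilon>\<^sub>t\<close>. Put
  \<open>c = min p q0\<close>. By a multiplicative Chernoff bound all empirical means are within \<open>\<epsilon>\<^sub>t\<close> of \<open>c\<close>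
  (only from below if \<open>p > q0\<close>), except with probability less than \<open>min \<delta> (\<rho> / 4)\<close>. In that event a
  stopping iteration returns the correct comparison of \<open>c\<close> with \<open>r\<close>, and iteration \<open>t\<close> can only fail
  to stop if \<open>\<bar>r - c\<bar> \<le> 3 \<epsilon>\<^sub>t\<close>. As \<open>r\<close> is uniform on an interval of length at least
  \<open>7 (q0 - p0) / 8\<close>, this has probability \<open>O(2\<^sup>-\<^sup>t)\<close>, and at most \<open>\<rho> / 2\<close> for the last \<open>t\<close>; this gives
  replicability. Batch sizes grow like \<open>4\<^sup>t\<close>, so the expected number of flips is dominated by
  \<open>\<Sum>\<^sub>t 4\<^sup>t 2\<^sup>-\<^sup>t = O(1 / \<rho>)\<close> and the worst case by \<open>4\<^sup>T = O(1 / \<rho>\<^sup>2)\<close>.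
\<close>

section \<open>The flip sequence and its generating functions\<close>

lemma prob_space_coin_flips: "prob_space (coin_flips p)"
  unfolding coin_flips_def by (intro prob_space_PiM prob_space_measure_pmf)

lemma sets_coin_flips [measurable_cong]:
  "sets (coin_flips p) = sets (Pi\<^sub>M UNIV (\<lambda>_. count_space UNIV))"
  unfolding coin_flips_def by (intro sets_PiM_cong) auto

lemma space_coin_flips [simp]: "space (coin_flips p) = UNIV"
  by (simp add: coin_flips_def space_PiM PiE_UNIV_domain)

lemma sets_coin_flips_Collect:
  assumes "Measurable.pred (Pi\<^sub>M UNIV (\<lambda>_. count_space UNIV)) P"
  shows "{S. P S} \<in> sets (coin_flips p)"
  using predE[OF assms] by (simp add: sets_coin_flips space_PiM PiE_UNIV_domain)

text \<open>The integrand depends on the coordinates in \<open>J\<close> only. Projecting to them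
  gives a finite product measure, where the integral factorises into equal one-coin
  integrals.\<close>

lemma nn_integral_coin_flips_prod:
  assumes "0 \<le> p" "p \<le> 1" "finite J"
  shows "(\<integral>\<^sup>+ S. (\<Prod>i\<in>J. f (S i)) \<partial>coin_flips p) = (f True * p + f False * (1 - p)) ^ card J"
proof -
  interpret product_prob_space "\<lambda>_::nat. measure_pmf (bernoulli_pmf p)" UNIV
    by (intro product_prob_spaceI prob_space_measure_pmf)
  let ?M = "\<lambda>_::nat. measure_pmf (bernoulli_pmf p)"
  have "(\<integral>\<^sup>+ S. (\<Prod>i\<in>J. f (S i)) \<partial>coin_flips p)
      = (\<integral>\<^sup>+ S. (\<Prod>i\<in>J. f (restrict S J i)) \<partial>Pi\<^sub>M UNIV ?M)"
    unfolding coin_flips_def by (intro nn_integral_cong prod.cong) auto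
  also have "\<dots> = (\<integral>\<^sup>+ S. (\<Prod>i\<in>J. f (S i)) \<partial>distr (Pi\<^sub>M UNIV ?M) (Pi\<^sub>M J ?M) (\<lambda>S. restrict S J))"
    using assms by (subst nn_integral_distr) (auto intro!: measurable_restrict_subset)
  also have "distr (Pi\<^sub>M UNIV ?M) (Pi\<^sub>M J ?M) (\<lambda>S. restrict S J) = Pi\<^sub>M J ?M"
    using assms by (intro distr_PiM_restrict_finite) auto
  also have "(\<integral>\<^sup>+ S. (\<Prod>i\<in>J. f (S i)) \<partial>Pi\<^sub>M J ?M) = (\<Prod>i\<in>J. \<integral>\<^sup>+ x. f x \<partial>measure_pmf (bernoulli_pmf p))"
    using assms by (intro product_nn_integral_prod) auto
  finally show ?thesis
    using assms by simp
qed

lemma mgf_coin_flips: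
  assumes "0 \<le> p" "p \<le> 1"
  shows "(\<integral>\<^sup>+ S. ennreal (exp (u * (\<Sum>i<m. of_bool (S (n + i))))) \<partial>coin_flips p)
    = ennreal ((1 - p + p * exp u) ^ m)"
proof -
  have "exp (u * (\<Sum>i<m. of_bool (S (n + i)))) = (\<Prod>i\<in>{n..<n+m}. exp (u * of_bool (S i)))" for S
  proof -
    have "(\<Sum>i<m. of_bool (S (n + i))) = (\<Sum>i\<in>{n..<n+m}. of_bool (S i) :: real)"
      using sum.shift_bounds_nat_ivl[of "\<lambda>i. of_bool (S i) :: real" 0 n m]
      by (simp add: add.commute atLeast0LessThan del: sum_of_bool_eq)
    then show ?thesis
      by (simp add: exp_sum[symmetric] sum_distrib_left[symmetric] del: sum_of_bool_eq)
  qed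
  then have "(\<integral>\<^sup>+ S. ennreal (exp (u * (\<Sum>i<m. of_bool (S (n + i))))) \<partial>coin_flips p)
     = (\<integral>\<^sup>+ S. (\<Prod>i\<in>{n..<n+m}. ennreal (exp (u * of_bool (S i)))) \<partial>coin_flips p)"
    by (simp add: prod_ennreal)
  also have "\<dots> = (ennreal (exp u) * p + 1 * (1 - p)) ^ m"
    by (subst nn_integral_coin_flips_prod[OF assms, where f = "\<lambda>b. ennreal (exp (u * of_bool b))"]) auto
  also have "\<dots> = ennreal ((1 - p + p * exp u) ^ m)"
    using assms
    by (simp add: ennreal_mult[symmetric] ennreal_plus[symmetric] ennreal_power mult.commute add.commute
        del: ennreal_plus)
  finally show ?thesis .
qed

section \<open>Chernoff bounds for batch means\<close>

definition batch_mean :: "nat \<Rightarrow> nat \<Rightarrow> (nat \<Rightarrow> bool) \<Rightarrow> real" where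
  "batch_mean n m S = (\<Sum>i<m. of_bool (S (n + i))) / real m"

lemma measurable_batch_mean [measurable]:
  "batch_mean n m \<in> borel_measurable (Pi\<^sub>M UNIV (\<lambda>_. count_space UNIV))"
  unfolding batch_mean_def by measurable

text \<open>Markov's inequality for the exponential of \<open>u\<close> times the number of heads.
  Keeping \<open>u\<close> on both sides of the event lets one statement serve both tails:
  \<open>u > 0\<close> gives the upper, \<open>u < 0\<close> the lower one.\<close>

lemma chernoff:
  assumes p: "0 \<le> p" "p \<le> 1" and m: "m > 0"
  shows "measure (coin_flips p) {S. u * a \<le> u * batch_mean n m S}
     \<le> (1 - p + p * exp u) ^ m * exp (- (u * a * m))"
proof -
  interpret prob_space "coin_flips p" by (rule prob_space_coin_flips)
  have eq: "exp (u * (\<Sum>i<m. of_bool (S (n + i)))) = exp (u * batch_mean n m S * m)" for S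
    using m by (simp add: batch_mean_def)
  have "{S. u * a \<le> u * batch_mean n m S}
      = {S\<in>UNIV. 1 \<le> ennreal (exp (- (u * a * m))) * ennreal (exp (u * batch_mean n m S * m))}"
  proof -
    have "u * a \<le> u * batch_mean n m S \<longleftrightarrow> u * a * m \<le> u * batch_mean n m S * m" for S
      using m by (intro mult_le_cancel_right_pos[symmetric]) simp
    then show ?thesis
      by (simp add: ennreal_mult[symmetric] exp_add[symmetric] del: mult_le_cancel_right)
  qed
  also have "emeasure (coin_flips p) \<dots> \<le> ennreal (exp (- (u * a * m))) *
      (\<integral>\<^sup>+ S. ennreal (exp (u * batch_mean n m S * m)) * indicator UNIV S \<partial>coin_flips p)"
    by (rule nn_integral_Markov_inequality) (use sets.top[of "coin_flips p"] in auto)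
  also have "\<dots> = ennreal (exp (- (u * a * m))) * ennreal ((1 - p + p * exp u) ^ m)"
    using mgf_coin_flips[OF p, of u n m] by (simp add: eq del: sum_of_bool_eq)
  finally show ?thesis
    using p by (simp add: emeasure_eq_measure ennreal_mult[symmetric] mult.commute)
qed

text \<open>Taylor's formula with remainder: \<open>3 / 5\<close> is half of \<open>6 / 5\<close>,
  which bounds \<open>exp t\<close> for \<open>t \<le> 1 / 6\<close>.\<close>

lemma exp_le_quadratic:
  fixes x :: real
  assumes "\<bar>x\<bar> \<le> 1 / 6"
  shows "exp x \<le> 1 + x + 3 / 5 * x\<^sup>2"
proof -
  obtain t where t: "\<bar>t\<bar> \<le> \<bar>x\<bar>" "exp x = (\<Sum>m<2. x ^ m / fact m) + exp t / fact 2 * x ^ 2"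
    using Maclaurin_exp_le by blast
  have "exp t \<le> exp (1 / 6)" using t assms by simp
  also have "\<dots> \<le> 1 + 1 / 6 + (1 / 6)\<^sup>2" by (rule exp_bound) auto
  also have "\<dots> \<le> 6 / 5" by (simp add: power2_eq_square)
  finally have "exp t / 2 * x\<^sup>2 \<le> 3 / 5 * x\<^sup>2" by (intro mult_right_mono) auto
  then show ?thesis using t by (simp add: numeral_2_eq_2)
qed

text \<open>Both Chernoff tails share the exponent: only \<open>u = \<plusminus>\<epsilon> / (6 q / 5)\<close> and the side change.\<close>

lemma chernoff_quadratic:
  assumes p: "0 \<le> p" "p \<le> 1" and m: "m > 0" and q: "0 < q" and \<epsilon>: "0 < \<epsilon>" "\<epsilon> \<le> q / 8"
    and s: "\<bar>s\<bar> = 1" and c: "c \<le> q" "1 - p + p * exp l \<le> 1 - c + c * exp l" "0 \<le> c"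
    and l: "l = s * (5 * \<epsilon> / (6 * q))"
  shows "measure (coin_flips p) {S. l * (c + s * \<epsilon>) \<le> l * batch_mean n m S}
    \<le> exp (- (5 * real m * \<epsilon>\<^sup>2 / (12 * q)))"
proof -
  have ss: "s * s = 1" using s by (auto simp: abs_if split: if_splits)
  have "\<bar>l\<bar> = 5 * \<epsilon> / (6 * q)" using s \<epsilon> q l by (simp add: abs_mult)
  also have "\<dots> \<le> 1 / 6" using \<epsilon> q by (simp add: field_simps)
  finally have ex: "exp l \<le> 1 + l + 3 / 5 * l\<^sup>2" by (rule exp_le_quadratic)
  have "1 - p + p * exp l \<le> 1 + c * (exp l - 1)" using c by (simp add: algebra_simps)
  also have "\<dots> \<le> 1 + c * (l + 3 / 5 * l\<^sup>2)" using ex c by (intro add_left_mono mult_left_mono) auto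
  \<comment> \<open>The linear term keeps \<open>c\<close>, as it has to cancel against the
    \<open>c\<close> in the tail event; only the quadratic term is enlarged to
    \<open>q\<close>.\<close>
  also have "\<dots> \<le> 1 + (c * l + q * (3 / 5 * l\<^sup>2))"
    using c mult_right_mono[of c q "3 / 5 * l\<^sup>2"] by (simp add: algebra_simps)
  also have "\<dots> \<le> exp (c * l + q * (3 / 5 * l\<^sup>2))" by (rule exp_ge_add_one_self)
  finally have 1: "1 - p + p * exp l \<le> exp (c * l + q * (3 / 5 * l\<^sup>2))" .
  have "measure (coin_flips p) {S. l * (c + s * \<epsilon>) \<le> l * batch_mean n m S}
      \<le> (1 - p + p * exp l) ^ m * exp (- (l * (c + s * \<epsilon>) * m))"
    by (rule chernoff[OF p m])
  also have "\<dots> \<le> exp (c * l + q * (3 / 5 * l\<^sup>2)) ^ m * exp (- (l * (c + s * \<epsilon>) * m))"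
    using 1 p by (intro mult_right_mono power_mono) (auto intro: add_nonneg_nonneg)
  also have "\<dots> = exp (m * (q * (3 / 5 * l\<^sup>2) - l * s * \<epsilon>))"
    by (simp add: exp_of_nat_mult[symmetric] exp_add[symmetric] algebra_simps)
  \<comment> \<open>As a function of \<open>l * s = \<bar>l\<bar>\<close> this quadratic is smallest
    at \<open>5 * \<epsilon> / (6 * q)\<close>, the value chosen for it.\<close>
  also have "q * (3 / 5 * l\<^sup>2) - l * s * \<epsilon> = - (5 * \<epsilon>\<^sup>2 / (12 * q))"
  proof -
    have "l\<^sup>2 = (5 * \<epsilon> / (6 * q))\<^sup>2" "l * s = 5 * \<epsilon> / (6 * q)"
      using ss by (simp_all add: l power_mult_distrib power2_eq_square mult.left_commute)
    then show ?thesis using q by (simp add: field_simps power2_eq_square)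
  qed
  finally show ?thesis by (simp add: mult.commute mult.left_commute)
qed

text \<open>For a bias above \<open>q\<close> only deviations below \<open>q\<close> are controlled: the variance of the coin may
  then be far larger than \<open>q\<close>.\<close>

definition accurate :: "real \<Rightarrow> real \<Rightarrow> real \<Rightarrow> real \<Rightarrow> bool" where
  "accurate q p \<epsilon> x \<longleftrightarrow> min p q - \<epsilon> < x \<and> (p \<le> q \<longrightarrow> x < p + \<epsilon>)"

lemma measurable_accurate [measurable]:
  "Measurable.pred borel (accurate q p \<epsilon>)"
  unfolding accurate_def by measurable

lemma prob_not_accurate:
  assumes p: "0 \<le> p" "p \<le> 1" and m: "m > 0" and q: "0 < q" and \<epsilon>: "0 < \<epsilon>" "\<epsilon> \<le> q / 8"
  shows "measure (coin_flips p) {S. \<not> accurate q p \<epsilon> (batch_mean n m S)}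
    \<le> 2 * exp (- (5 * real m * \<epsilon>\<^sup>2 / (12 * q)))"
proof -
  interpret prob_space "coin_flips p" by (rule prob_space_coin_flips)
  let ?B = "exp (- (5 * real m * \<epsilon>\<^sup>2 / (12 * q)))"
  let ?lo = "{S. batch_mean n m S \<le> min p q - \<epsilon>}" and ?hi = "{S. p \<le> q \<and> p + \<epsilon> \<le> batch_mean n m S}"
  have [measurable]: "?lo \<in> sets (coin_flips p)" "?hi \<in> sets (coin_flips p)"
    by (intro sets_coin_flips_Collect; measurable)+
  define l where "l = 5 * \<epsilon> / (6 * q)"
  have l: "l > 0" using \<epsilon> q by (simp add: l_def)
  have "measure (coin_flips p) {S. - l * (min p q + - 1 * \<epsilon>) \<le> - l * batch_mean n m S} \<le> ?B"
  proof (rule chernoff_quadratic[OF p m q \<epsilon>])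
    \<comment> \<open>For a negative exponent the generating function decreases in the bias, so
      passing from \<open>p\<close> down to \<open>min p q\<close> bounds it from above.\<close>
    have "(p - min p q) * (exp (- l) - 1) \<le> 0" using l by (intro mult_nonneg_nonpos) auto
    then show "1 - p + p * exp (- l) \<le> 1 - min p q + min p q * exp (- l)" by (simp add: algebra_simps)
  qed (use p q in \<open>auto simp: l_def\<close>)
  also have "{S. - l * (min p q + - 1 * \<epsilon>) \<le> - l * batch_mean n m S} = ?lo"
    using l by auto
  finally have lo: "measure (coin_flips p) ?lo \<le> ?B" .
  have hi: "measure (coin_flips p) ?hi \<le> ?B"
  proof (cases "p \<le> q")
    case True
    have "measure (coin_flips p) {S. l * (p + 1 * \<epsilon>) \<le> l * batch_mean n m S} \<le> ?B"
      by (rule chernoff_quadratic[OF p m q \<epsilon>]) (use True p in \<open>auto simp: l_def\<close>)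
    also have "{S. l * (p + 1 * \<epsilon>) \<le> l * batch_mean n m S} = ?hi" using l True by auto
    finally show ?thesis .
  qed simp
  have "{S. \<not> accurate q p \<epsilon> (batch_mean n m S)} = ?lo \<union> ?hi"
    by (auto simp: accurate_def)
  also have "measure (coin_flips p) \<dots> \<le> measure (coin_flips p) ?lo + measure (coin_flips p) ?hi"
    by (intro measure_Un_le) auto
  finally show ?thesis using lo hi by simp
qed

section \<open>Stopping rule, geometric sums and measurability of the loop\<close>

lemma ln_2_ge_half: "1 / 2 \<le> ln (2::real)"
  using ln_le_minus_one[of "1 / 2 :: real"] by (simp add: ln_div)

text \<open>For \<open>e \<ge> 0\<close> the smaller endpoint distance is
  \<open>\<bar>\<bar>x - r\<bar> - e\<bar>\<close>, which exceeds \<open>e\<close> exactly if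
  \<open>\<bar>x - r\<bar> > 2 * e\<close>.\<close>

lemma tester_loop_Suc:
  "tester_loop p0 q0 T \<delta> S r (Suc k) t n =
     (let m = batch_size p0 q0 T \<delta> t; x = batch_mean n m S
      in if \<bar>x - r\<bar> > 2 * accuracy p0 q0 t
         then (if x > r then Accept else Reject, n + m)
         else tester_loop p0 q0 T \<delta> S r k (Suc t) (n + m))"
proof -
  have "min \<bar>x - e - r\<bar> \<bar>x + e - r\<bar> > e \<longleftrightarrow> \<bar>x - r\<bar> > 2 * e" for x e :: real
    by linarith
  then show ?thesis
    by (simp only: tester_loop.simps Let_def batch_mean_def)
qed

lemma measure_pair_Times:
  assumes "prob_space M1" "prob_space M2" "A \<in> sets M1" "B \<in> sets M2"
  shows "measure (M1 \<Otimes>\<^sub>M M2) (A \<times> B) = measure M1 A * measure M2 B"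
proof -
  interpret M2: prob_space M2 by fact
  show ?thesis
    using assms by (simp add: measure_def M2.emeasure_pair_measure_Times enn2real_mult)
qed

lemma sum_power_four_le: "(\<Sum>s<n. 4 ^ Suc s) \<le> 2 * (4::real) ^ n"
proof (induction n)
  case (Suc n)
  moreover have "0 \<le> (4::real) ^ n" by simp
  ultimately show ?case unfolding sum.lessThan_Suc power_Suc by linarith
qed simp

lemma sum_power_two_le: "(\<Sum>s<n. 2 ^ s) \<le> (2::real) ^ n"
  by (induction n) auto

lemma measurable_tester_loop:
  assumes [measurable]: "(\<lambda>r. r) \<in> borel_measurable M"
  shows "(\<lambda>(S, r). tester_loop p0 q0 T \<delta> S r k t n)
    \<in> measurable (Pi\<^sub>M UNIV (\<lambda>_. count_space UNIV) \<Otimes>\<^sub>M M) (count_space UNIV)"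
proof (induction k arbitrary: t n)
  case 0
  then show ?case by (simp add: split_beta)
next
  case (Suc k)
  have [measurable]: "snd \<in> borel_measurable (Pi\<^sub>M UNIV (\<lambda>_. count_space (UNIV::bool set)) \<Otimes>\<^sub>M M)"
    using measurable_compose[OF measurable_snd assms] by simp
  note Suc.IH[unfolded split_beta, measurable]
  show ?case unfolding tester_loop_Suc split_beta Let_def by measurable
qed

section \<open>Parameters and their numerical bounds\<close>

locale adaptive_tester =
  fixes p0 q0 \<rho> \<delta> :: real
  assumes p0_nonneg: "0 \<le> p0" and p0_less_q0: "p0 < q0" and q0_le_1: "q0 \<le> 1"
    and \<delta>_pos: "0 < \<delta>" and \<delta>_less_\<rho>: "\<delta> < \<rho>" and \<rho>_le_1: "\<rho> \<le> 1" and \<delta>_less_half: "\<delta> < 1 / 2"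
begin

definition T :: nat where "T = num_iterations \<rho>"
definition \<delta>' :: real where "\<delta>' = min \<delta> (\<rho> / 4)"
definition L :: real where "L = ln (2 * real T / \<delta>')"
definition m :: "nat \<Rightarrow> nat" where "m = batch_size p0 q0 T \<delta>'"
definition \<epsilon> :: "nat \<Rightarrow> real" where "\<epsilon> = accuracy p0 q0"
text \<open>The position of the first flip of batch \<open>t\<close>; iterations are counted from 1,
  so \<open>N 1 = 0\<close>.\<close>

definition N :: "nat \<Rightarrow> nat" where "N t = (\<Sum>s\<in>{1..<t}. m s)"
definition p_hat :: "nat \<Rightarrow> (nat \<Rightarrow> bool) \<Rightarrow> real" where "p_hat t = batch_mean (N t) (m t)"
text \<open>\<open>1152 = 3 * 384\<close>, where \<open>384 = 3 * 16 * 8\<close> bounds the unrounded batch size by way of \<open>L_le\<close> and the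
  factor 3 absorbs the rounding.\<close>

definition K :: real where "K = 1152 * (q0 * ln (1 / \<delta>) / (q0 - p0)\<^sup>2)"

lemma \<rho>_pos: "0 < \<rho>" and q0_pos: "0 < q0" and \<delta>'_pos: "0 < \<delta>'"
  using \<delta>_pos \<delta>_less_\<rho> p0_nonneg p0_less_q0 by (auto simp: \<delta>'_def)

lemma \<epsilon>_pos: "0 < \<epsilon> t" and \<epsilon>_le: "1 \<le> t \<Longrightarrow> \<epsilon> t \<le> q0 / 8"
proof -
  show "0 < \<epsilon> t" using p0_less_q0 by (simp add: \<epsilon>_def accuracy_def)
  have mono: "\<epsilon> t \<le> \<epsilon> s" if "s \<le> t" for s t
    unfolding \<epsilon>_def accuracy_def using that p0_less_q0 by (intro divide_left_mono power_increasing) auto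
  show "\<epsilon> t \<le> q0 / 8" if "1 \<le> t"
  proof -
    have "\<epsilon> t \<le> \<epsilon> 1" using that by (rule mono)
    also have "\<dots> \<le> q0 / 8" using p0_nonneg by (simp add: \<epsilon>_def accuracy_def)
    finally show ?thesis .
  qed
qed

text \<open>Rounding up adds less than 1 to the exponent, so it at most doubles
  \<open>16 / \<rho>\<close>. The lower bound makes the last accuracy fine enough for replicability;
  the upper bound controls the sample counts.\<close>

lemma T_ge: "4 \<le> T" and two_power_T_ge: "16 / \<rho> \<le> 2 ^ T" and two_power_T_le: "2 ^ T \<le> 32 / \<rho>"
  and T_le: "real T \<le> 5 + log 2 (1 / \<rho>)"
proof -
  have l: "0 \<le> log 2 (1 / \<rho>)" using \<rho>_pos \<rho>_le_1 by simp
  have T: "real T = of_int \<lceil>4 + log 2 (1 / \<rho>)\<rceil>" using l by (simp add: T_def num_iterations_def)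
  then have 1: "4 + log 2 (1 / \<rho>) \<le> real T" by linarith
  with l show "4 \<le> T" by linarith
  show 2: "real T \<le> 5 + log 2 (1 / \<rho>)" using T by linarith
  have pow: "2 ^ T = 2 powr real T" by (simp add: powr_realpow)
  have "2 powr (4 + log 2 (1 / \<rho>)) \<le> 2 powr real T" using 1 by simp
  then show "16 / \<rho> \<le> 2 ^ T" using \<rho>_pos by (simp add: pow powr_add)
  have "2 powr real T \<le> 2 powr (5 + log 2 (1 / \<rho>))" using 2 by simp
  then show "2 ^ T \<le> 32 / \<rho>" using \<rho>_pos by (simp add: pow powr_add)
qed

lemma ln_inverse_\<delta>_ge: "1 / 2 \<le> ln (1 / \<delta>)"
proof -
  have "2 \<le> 1 / \<delta>" using \<delta>_pos \<delta>_less_half by (simp add: field_simps)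
  then have "ln 2 \<le> ln (1 / \<delta>)" by (intro ln_mono) auto
  with ln_2_ge_half show ?thesis by linarith
qed

text \<open>The argument of the logarithm is polynomial in \<open>x = 1 / \<delta>\<close>:
  \<open>\<delta> < \<rho>\<close> gives \<open>1 / \<rho> \<le> x\<close>, whence
  \<open>T \<le> 5 * x\<close>, and \<open>1 / \<delta>' \<le> 4 * x\<close>. As
  \<open>x > 2\<close>, the product \<open>40 * x ^ 2\<close> is below \<open>x ^ 8\<close>.\<close>

lemma L_pos: "0 < L" and L_le: "L \<le> 8 * ln (1 / \<delta>)"
proof -
  define x where "x = 1 / \<delta>"
  have x: "2 < x" using \<delta>_pos \<delta>_less_half by (simp add: x_def field_simps)
  have inv: "1 / \<delta>' \<le> 4 * x" "1 / \<rho> \<le> x"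
    using \<delta>_pos \<delta>_less_\<rho> by (auto simp: x_def \<delta>'_def min_def field_simps)
  have "log 2 (1 / \<rho>) \<le> log 2 x" using inv \<rho>_pos x by simp
  also have "\<dots> \<le> 2 * ln x"
  proof -
    have "ln x * (1 / 2) \<le> ln x * ln 2" using x ln_2_ge_half by (intro mult_left_mono) auto
    then show ?thesis by (simp add: log_def field_simps)
  qed
  also have "\<dots> \<le> 2 * x" using x ln_le_minus_one[of x] by simp
  finally have T: "real T \<le> 5 * x" using T_le x by linarith
  have "1 \<le> 2 * real T" using T_ge by simp
  also have "\<dots> < 2 * real T / \<delta>'"
    using T_ge \<delta>'_pos \<delta>_less_half by (simp add: less_divide_eq \<delta>'_def)
  finally show "0 < L" unfolding L_def by (rule ln_gt_zero)
  have "2 * real T * (1 / \<delta>') \<le> (2 * (5 * x)) * (4 * x)"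
    using T inv x \<delta>'_pos by (intro mult_mono) auto
  also have "\<dots> \<le> x ^ 6 * x\<^sup>2"
  proof -
    have "(2::real) ^ 6 \<le> x ^ 6" using x by (intro power_mono) auto
    then have "40 * x\<^sup>2 \<le> x ^ 6 * x\<^sup>2" by (intro mult_right_mono) auto
    then show ?thesis by (simp add: power2_eq_square)
  qed
  also have "\<dots> = x ^ 8" by (simp flip: power_add)
  finally have "L \<le> ln (x ^ 8)"
    unfolding L_def using T_ge \<delta>'_pos x by (subst ln_le_cancel_iff) auto
  then show "L \<le> 8 * ln (1 / \<delta>)" using x by (simp add: ln_realpow x_def)
qed

lemma K_pos: "0 < K"
  using q0_pos p0_less_q0 ln_inverse_\<delta>_ge by (simp add: K_def)

lemma m_ge: "3 * q0 / (\<epsilon> t)\<^sup>2 * L \<le> real (m t)" and m_pos: "0 < m t" and m_le: "real (m t) \<le> K * 4 ^ t"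
proof -
  let ?y = "3 * q0 / (\<epsilon> t)\<^sup>2 * L"
  have y: "0 < ?y" using q0_pos \<epsilon>_pos[of t] L_pos by simp
  then have m: "real (m t) = of_int \<lceil>?y\<rceil>"
    by (simp add: m_def batch_size_def \<epsilon>_def L_def)
  then show "?y \<le> real (m t)" by simp
  with y have "0 < real (m t)" by linarith
  then show "0 < m t" by simp
  define Q where "Q = q0 / (q0 - p0)\<^sup>2"
  \<comment> \<open>Together with \<open>ln (1 / \<delta>) \<ge> 1 / 2\<close> this keeps the size
    bound away from 0, so that rounding up costs only a constant factor.\<close>
  have Q: "1 \<le> Q"
  proof -
    have "(q0 - p0)\<^sup>2 \<le> q0\<^sup>2" using p0_nonneg p0_less_q0 by (intro power_mono) auto
    also have "\<dots> \<le> q0" using q0_pos q0_le_1 by (simp add: power2_eq_square mult_left_le)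
    finally show ?thesis using p0_less_q0 by (simp add: Q_def)
  qed
  have "((4::real) ^ t) * 16 = (2 ^ (t + 2))\<^sup>2"
    by (simp add: power_add power_mult_distrib power2_eq_square flip: power_mult_distrib)
  then have "?y = 48 * 4 ^ t * Q * L"
    by (simp add: \<epsilon>_def accuracy_def Q_def power_divide)
  also have "\<dots> \<le> 48 * 4 ^ t * Q * (8 * ln (1 / \<delta>))"
    using Q L_le by (intro mult_left_mono) auto
  finally have 1: "?y \<le> 384 * (4 ^ t * Q * ln (1 / \<delta>))" by simp
  have "1 * (1 / 2) \<le> 4 ^ t * Q * ln (1 / \<delta>)"
    using Q ln_inverse_\<delta>_ge mult_mono[of 1 "4 ^ t" 1 Q] by (intro mult_mono) auto
  then have "?y + 1 \<le> 1152 * (4 ^ t * Q * ln (1 / \<delta>))" using 1 by linarith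
  moreover have "real (m t) \<le> ?y + 1" using m by linarith
  ultimately show "real (m t) \<le> K * 4 ^ t" by (simp add: K_def Q_def mult_ac)
qed

section \<open>Runs of the loop\<close>

lemma N_Suc: "1 \<le> t \<Longrightarrow> N (Suc t) = N t + m t"
  by (simp add: N_def)

lemma rAdaptiveCoinTester_eq: "rAdaptiveCoinTester p0 q0 \<rho> \<delta> S r = tester_loop p0 q0 T \<delta>' S r T 1 (N 1)"
  by (simp add: rAdaptiveCoinTester_def T_def \<delta>'_def N_def Let_def)

text \<open>Batch boundaries do not depend on outcomes: whenever iteration \<open>t\<close> begins,
  exactly \<open>N t\<close> flips have been drawn.\<close>

lemma tester_loop_step:
  assumes "1 \<le> t"
  shows "tester_loop p0 q0 T \<delta>' S r (Suc k) t (N t) =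
    (if \<bar>p_hat t S - r\<bar> > 2 * \<epsilon> t then (if p_hat t S > r then Accept else Reject, N (Suc t))
     else tester_loop p0 q0 T \<delta>' S r k (Suc t) (N (Suc t)))"
  using assms by (simp add: tester_loop_Suc N_Suc p_hat_def m_def \<epsilon>_def Let_def del: tester_loop.simps)

text \<open>Minimality of the stopping iteration is not recorded: on accurate batches, and for
  \<open>r < q0\<close>, every iteration that passes its test gives the same verdict. The second
  alternative is the default \<open>Reject\<close>.\<close>

lemma tester_loop_verdict:
  assumes "1 \<le> t"
  shows "(\<exists>s\<in>{t..<t+k}. \<bar>p_hat s S - r\<bar> > 2 * \<epsilon> s \<and>
            fst (tester_loop p0 q0 T \<delta>' S r k t (N t)) = (if p_hat s S > r then Accept else Reject))
       \<or> (fst (tester_loop p0 q0 T \<delta>' S r k t (N t)) = Reject \<and> (\<forall>s\<in>{t..<t+k}. \<bar>p_hat s S - r\<bar> \<le> 2 * \<epsilon> s))"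
  using assms
proof (induction k arbitrary: t)
  case (Suc k)
  show ?case
  proof (cases "\<bar>p_hat t S - r\<bar> > 2 * \<epsilon> t")
    case True
    then show ?thesis using Suc.prems
      by (intro disjI1 bexI[of _ t]) (auto simp: tester_loop_step simp del: tester_loop.simps)
  next
    case False
    then have eq: "tester_loop p0 q0 T \<delta>' S r (Suc k) t (N t) = tester_loop p0 q0 T \<delta>' S r k (Suc t) (N (Suc t))"
      using Suc.prems by (simp add: tester_loop_step del: tester_loop.simps)
    have "{t..<t + Suc k} = insert t {Suc t..<Suc t + k}" by auto
    then show ?thesis using Suc.IH[of "Suc t"] False unfolding eq by fastforce
  qed
qed simp

text \<open>Batch \<open>s + 1\<close> is drawn only if iteration \<open>s\<close> was undecided and
  is charged to that single event; this over-counts, as all earlier iterations must have been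
  undecided too. Batch \<open>t\<close> is always drawn, and \<open>Suc k\<close> iterations have
  \<open>k\<close> transitions.\<close>

lemma tester_loop_samples:
  assumes "1 \<le> t"
  shows "snd (tester_loop p0 q0 T \<delta>' S r (Suc k) t (N t))
    \<le> N (Suc t) + (\<Sum>s\<in>{t..<t+k}. m (Suc s) * of_bool (\<bar>p_hat s S - r\<bar> \<le> 2 * \<epsilon> s))"
  using assms
proof (induction k arbitrary: t)
  case 0
  then show ?case by (subst tester_loop_step) auto
next
  case (Suc k)
  show ?case
  proof (cases "\<bar>p_hat t S - r\<bar> > 2 * \<epsilon> t")
    case True
    then show ?thesis using Suc.prems by (subst tester_loop_step) auto
  next
    case False
    have "{t..<t + Suc k} = insert t {Suc t..<Suc t + k}" by auto
    then have "(\<Sum>s\<in>{t..<t + Suc k}. m (Suc s) * of_bool (\<bar>p_hat s S - r\<bar> \<le> 2 * \<epsilon> s))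
        = m (Suc t) + (\<Sum>s\<in>{Suc t..<Suc t + k}. m (Suc s) * of_bool (\<bar>p_hat s S - r\<bar> \<le> 2 * \<epsilon> s))"
      using False by (simp del: sum_mult_of_bool_eq)
    then show ?thesis using Suc.IH[of "Suc t"] False Suc.prems
      by (subst tester_loop_step) (simp_all add: N_Suc[of "Suc t"] del: tester_loop.simps sum_mult_of_bool_eq)
  qed
qed

section \<open>The event that all batches are accurate\<close>

definition good :: "real \<Rightarrow> (nat \<Rightarrow> bool) \<Rightarrow> bool" where
  "good p S \<longleftrightarrow> (\<forall>t\<in>{1..T}. accurate q0 p (\<epsilon> t) (p_hat t S))"

lemma sets_not_accurate: "{S. \<not> accurate q0 p (\<epsilon> t) (p_hat t S)} \<in> sets (coin_flips p)"
  unfolding p_hat_def by (intro sets_coin_flips_Collect) measurable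

lemma sets_not_good: "{S. \<not> good p S} \<in> sets (coin_flips p)"
proof -
  have "{S. \<not> good p S} = (\<Union>t\<in>{1..T}. {S. \<not> accurate q0 p (\<epsilon> t) (p_hat t S)})"
    by (auto simp: good_def)
  then show ?thesis using sets_not_accurate by auto
qed

text \<open>The batch size makes the exponent at least \<open>5 / 12 * (3 * L)\<close>, which
  exceeds \<open>L\<close>; so both tails together stay strictly below
  \<open>2 * exp (- L) = \<delta>' / T\<close>. Strictness carries over to
  \<open>solves_coin_problem\<close>.\<close>

lemma prob_not_accurate_less:
  assumes "0 \<le> p" "p \<le> 1" "1 \<le> t"
  shows "measure (coin_flips p) {S. \<not> accurate q0 p (\<epsilon> t) (p_hat t S)} < \<delta>' / T"
proof -
  have "L < 5 / 12 * (3 * L)" using L_pos by simp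
  also have "3 * L = 3 * q0 / (\<epsilon> t)\<^sup>2 * L * (\<epsilon> t)\<^sup>2 / q0"
    using q0_pos \<epsilon>_pos[of t] by simp
  also have "5 / 12 * \<dots> \<le> 5 / 12 * (real (m t) * (\<epsilon> t)\<^sup>2 / q0)"
    using m_ge[of t] q0_pos by (intro mult_left_mono divide_right_mono mult_right_mono) auto
  finally have "exp (- (5 * real (m t) * (\<epsilon> t)\<^sup>2 / (12 * q0))) < exp (- L)" by simp
  moreover have "exp (- L) = \<delta>' / (2 * T)"
    using T_ge \<delta>'_pos by (simp add: L_def exp_minus)
  ultimately show ?thesis
    using prob_not_accurate[of p "m t" q0 "\<epsilon> t" "N t"] assms m_pos \<epsilon>_pos \<epsilon>_le q0_pos
    by (simp add: p_hat_def)
qed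

lemma prob_not_good:
  assumes "0 \<le> p" "p \<le> 1"
  shows "measure (coin_flips p) {S. \<not> good p S} < \<delta>'"
proof -
  interpret prob_space "coin_flips p" by (rule prob_space_coin_flips)
  let ?B = "\<lambda>t. {S. \<not> accurate q0 p (\<epsilon> t) (p_hat t S)}"
  have "{S. \<not> good p S} = (\<Union>t\<in>{1..T}. ?B t)"
    by (auto simp: good_def)
  also have "measure (coin_flips p) \<dots> \<le> (\<Sum>t\<in>{1..T}. measure (coin_flips p) (?B t))"
    using sets_not_accurate by (intro measure_UNION_le) auto
  also have "\<dots> < (\<Sum>t\<in>{1..T}. \<delta>' / T)"
    using assms T_ge prob_not_accurate_less by (intro sum_strict_mono) auto
  also have "\<dots> = \<delta>'" using T_ge by simp
  finally show ?thesis .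
qed

text \<open>The mean is less than \<open>\<epsilon> t\<close> from \<open>min p q0\<close> and more
  than twice that from \<open>r\<close>, so both lie on one side of \<open>r\<close>. For
  \<open>p > q0\<close> only the lower deviation is bounded, but \<open>min p q0 = q0 > r\<close>
  then holds anyway, and the mean cannot drop below \<open>r - 2 * \<epsilon> t\<close>.\<close>

lemma good_decided:
  assumes "accurate q0 p (\<epsilon> t) (p_hat t S)" "\<bar>p_hat t S - r\<bar> > 2 * \<epsilon> t" "r < q0"
  shows "p_hat t S > r \<longleftrightarrow> min p q0 > r"
  using assms \<epsilon>_pos[of t] by (auto simp: accurate_def min_def split: if_splits)

text \<open>Triangle inequality. For \<open>p > q0\<close> only \<open>q0 - r > 0\<close> has to be
  bounded, and the lower deviation suffices for that.\<close>

lemma good_undecided: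
  assumes "accurate q0 p (\<epsilon> t) (p_hat t S)" "\<bar>p_hat t S - r\<bar> \<le> 2 * \<epsilon> t" "r < q0"
  shows "\<bar>r - min p q0\<bar> \<le> 3 * \<epsilon> t"
  using assms \<epsilon>_pos[of t] by (auto simp: accurate_def min_def split: if_splits)

text \<open>A loop that never stops returns \<open>Reject\<close>. Under \<open>far\<close>, either
  that is the right answer or \<open>good_undecided\<close> rules out that iteration
  \<open>T\<close> was undecided.\<close>

lemma verdict_if_good:
  assumes "good p S" "r < q0" and far: "min p q0 \<le> r \<or> \<bar>r - min p q0\<bar> > 3 * \<epsilon> T"
  shows "fst (rAdaptiveCoinTester p0 q0 \<rho> \<delta> S r) = (if min p q0 > r then Accept else Reject)"
proof -
  have T: "T \<in> {1..T}" using T_ge by simp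
  have acc: "accurate q0 p (\<epsilon> t) (p_hat t S)" if "t \<in> {1..T}" for t
    using assms that by (auto simp: good_def)
  have I: "{1..<1+T} = {1..T}" by auto
  consider s where "s \<in> {1..T}" "2 * \<epsilon> s < \<bar>p_hat s S - r\<bar>"
      "fst (rAdaptiveCoinTester p0 q0 \<rho> \<delta> S r) = (if p_hat s S > r then Accept else Reject)"
    | "fst (rAdaptiveCoinTester p0 q0 \<rho> \<delta> S r) = Reject"
      "\<forall>s\<in>{1..T}. \<bar>p_hat s S - r\<bar> \<le> 2 * \<epsilon> s"
    using tester_loop_verdict[of 1 T S r] unfolding rAdaptiveCoinTester_eq I by blast
  then show ?thesis
  proof cases
    case 1
    then show ?thesis using good_decided[OF acc] assms by auto
  next
    case 2
    then show ?thesis using good_undecided[OF acc[OF T], of r] assms T by auto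
  qed
qed

text \<open>The threshold interval keeps a margin of \<open>4 / 64 * \<rho> * (q0 - p0)\<close> at
  its ends, so the last radius of uncertainty fits inside it.\<close>

lemma \<epsilon>_T_le: "3 * \<epsilon> T \<le> 3 / 64 * \<rho> * (q0 - p0)"
proof -
  have "\<epsilon> T = (q0 - p0) / 4 * (1 / 2 ^ T)" by (simp add: \<epsilon>_def accuracy_def)
  also have "\<dots> \<le> (q0 - p0) / 4 * (\<rho> / 16)"
    using two_power_T_ge \<rho>_pos p0_less_q0 by (intro mult_left_mono) (auto simp: field_simps)
  finally show ?thesis by (simp add: field_simps)
qed

section \<open>The random threshold\<close>

definition R :: "real measure" where "R = threshold_measure p0 q0 \<rho>"
definition b :: real where "b = \<rho> * (q0 - p0) / 16"

abbreviation tester :: "real coin_algorithm" where "tester \<equiv> rAdaptiveCoinTester p0 q0 \<rho> \<delta>"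

lemma b_pos: "0 < b" and b_le: "b \<le> (q0 - p0) / 16"
  using \<rho>_pos \<rho>_le_1 p0_less_q0 by (auto simp: b_def)

lemma R_eq: "R = uniform_measure (restrict_space lborel {p0 + b..q0 - b}) {p0 + b..q0 - b}"
  by (simp add: R_def threshold_measure_def Let_def b_def)

lemma space_R: "space R = {p0 + b..q0 - b}"
  by (simp add: R_eq)

lemma sets_R: "sets R = sets (restrict_space borel {p0 + b..q0 - b})"
  by (simp add: R_eq cong: sets_restrict_space_cong)

lemma prob_space_R: "prob_space R"
  unfolding R_eq using b_le p0_less_q0
  by (intro prob_space_uniform_measure) (auto simp: emeasure_restrict_space)

lemma measurable_R: "(\<lambda>r. r) \<in> borel_measurable R"
  unfolding measurable_cong_sets[OF sets_R refl] by (intro measurable_restrict_space1) auto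

lemma sets_near: "{r\<in>space R. \<bar>r - c\<bar> \<le> w} \<in> sets R"
proof -
  note measurable_R[measurable]
  show ?thesis by measurable
qed

text \<open>The window has length \<open>2 * w\<close>, while \<open>b_le\<close> leaves the
  threshold interval at least \<open>7 / 8\<close> of the gap \<open>q0 - p0\<close>.\<close>

lemma prob_near:
  assumes "0 \<le> w"
  shows "measure R {r\<in>space R. \<bar>r - c\<bar> \<le> w} \<le> 16 / 7 * (w / (q0 - p0))"
proof -
  define I where "I = {p0 + b..q0 - b}"
  define W where "W = {r\<in>space R. \<bar>r - c\<bar> \<le> w}"
  have W: "W = I \<inter> {c - w..c + w}" by (auto simp: space_R W_def I_def)
  have len: "7 / 8 * (q0 - p0) \<le> measure lborel I" "emeasure lborel I \<noteq> 0"
    using b_le p0_less_q0 by (simp_all add: I_def emeasure_lborel_Icc_eq)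
  have fin: "emeasure lborel I \<noteq> \<infinity>" by (simp add: I_def emeasure_lborel_Icc_eq)
  have "measure R W = measure (restrict_space lborel I) (I \<inter> W) / measure (restrict_space lborel I) I"
    unfolding R_eq I_def[symmetric] using len fin
    by (intro measure_uniform_measure) (auto simp: emeasure_restrict_space W sets_restrict_space I_def)
  also have "\<dots> = measure lborel W / measure lborel I"
    by (simp add: measure_restrict_space W I_def)
  also have "\<dots> \<le> (2 * w) / (7 / 8 * (q0 - p0))"
  proof (intro frac_le)
    have "measure lborel W \<le> measure lborel {c - w..c + w}"
      unfolding W by (intro measure_mono_fmeasurable) (auto simp: I_def fmeasurable_def emeasure_lborel_Icc_eq)
    then show "measure lborel W \<le> 2 * w" using assms by simp
  qed (use len p0_less_q0 assms in auto)
  finally show ?thesis by (simp add: W_def field_simps)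
qed

section \<open>Measurability, correctness and replicability\<close>

lemma randomized: "randomized_coin_algorithm R tester"
  unfolding randomized_coin_algorithm_def rAdaptiveCoinTester_eq
  using prob_space_R measurable_tester_loop[OF measurable_R] by auto

text \<open>The exceptional event concerns the flips only: the verdict is right on good flips for
  every threshold, so the error is that of the flips alone.\<close>

lemma verdict_prob_less:
  assumes p: "0 \<le> p" "p \<le> 1"
    and "\<And>S r. r \<in> space R \<Longrightarrow> good p S \<Longrightarrow> fst (tester S r) \<noteq> v"
  shows "verdict_prob R tester p v < \<delta>"
proof -
  interpret C: prob_space "coin_flips p" by (rule prob_space_coin_flips)
  interpret R: prob_space R by (rule prob_space_R)
  interpret P: pair_prob_space "coin_flips p" R ..
  have "verdict_prob R tester p v \<le> measure (coin_flips p \<Otimes>\<^sub>M R) ({S. \<not> good p S} \<times> space R)"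
    unfolding verdict_prob_def using assms(3) sets_not_good
    by (intro P.finite_measure_mono) (auto simp: space_pair_measure)
  also have "\<dots> = measure (coin_flips p) {S. \<not> good p S}"
    using sets_not_good prob_space_R prob_space_coin_flips
    by (subst measure_pair_Times) (auto simp: R.prob_space)
  also have "\<dots> < \<delta>'" using p by (rule prob_not_good)
  also have "\<dots> \<le> \<delta>" by (simp add: \<delta>'_def)
  finally show ?thesis .
qed

lemma solves: "solves_coin_problem p0 q0 \<delta> R tester"
  unfolding solves_coin_problem_def
proof (intro ballI conjI impI)
  fix p :: real assume p: "p \<in> {0..1}"
  \<comment> \<open>Every threshold is at least \<open>p0 + b > p\<close>, so the default
    \<open>Reject\<close> is right.\<close>
  show "verdict_prob R tester p Accept < \<delta>" if "p \<le> p0"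
    using p that b_pos p0_less_q0
    by (intro verdict_prob_less) (auto simp: verdict_if_good space_R)
  show "verdict_prob R tester p Reject < \<delta>" if "q0 \<le> p"
  proof (intro verdict_prob_less)
    fix S r assume r: "r \<in> space R" and g: "good p S"
    \<comment> \<open>Here the default \<open>Reject\<close> would be wrong; the margin
      \<open>b\<close> keeps every threshold far enough below \<open>q0\<close> for the loop to
      stop.\<close>
    have "3 * \<epsilon> T < b" using \<epsilon>_T_le b_pos by (simp add: b_def)
    moreover have "r \<le> q0 - b" using r by (simp add: space_R)
    ultimately have "\<bar>r - min p q0\<bar> > 3 * \<epsilon> T" using that by (simp add: min_def)
    moreover have "r < q0" using r b_pos by (simp add: space_R)
    ultimately show "fst (tester S r) \<noteq> Reject" using that g by (simp add: verdict_if_good)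
  qed (use p in auto)
qed

text \<open>The budget \<open>\<rho>\<close> splits into \<open>\<rho> / 2\<close> for a threshold
  within \<open>3 * \<epsilon> T\<close> of \<open>min p q0\<close> and \<open>\<rho> / 4\<close>
  for each run failing to be good, which is why \<open>\<delta>' \<le> \<rho> / 4\<close>. Otherwise
  both runs return the same comparison of \<open>min p q0\<close> with \<open>r\<close>.\<close>

lemma replicable: "replicable \<rho> R tester"
  unfolding replicable_def
proof
  fix p :: real assume p: "p \<in> {0..1}"
  let ?C = "coin_flips p"
  interpret C: prob_space ?C by (rule prob_space_coin_flips)
  interpret R: prob_space R by (rule prob_space_R)
  interpret CC: pair_prob_space ?C ?C ..
  interpret P: pair_prob_space R "?C \<Otimes>\<^sub>M ?C" ..
  let ?M = "R \<Otimes>\<^sub>M ?C \<Otimes>\<^sub>M ?C"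
  let ?X = "{(r, S, S') \<in> space ?M. fst (tester S r) = fst (tester S' r)}"
  let ?B = "{S. \<not> good p S}" and ?W = "{r\<in>space R. \<bar>r - min p q0\<bar> \<le> 3 * \<epsilon> T}"
  let ?E1 = "?W \<times> (UNIV \<times> UNIV)" and ?E2 = "space R \<times> (?B \<times> UNIV)" and ?E3 = "space R \<times> (UNIV \<times> ?B)"
  have U: "UNIV \<in> sets ?C" using sets.top[of ?C] by simp
  have CC: "measure (?C \<Otimes>\<^sub>M ?C) (A \<times> B) = measure ?C A * measure ?C B"
    if "A \<in> sets ?C" "B \<in> sets ?C" for A B
    using that prob_space_coin_flips by (intro measure_pair_Times)
  have CC': "measure ?M (A \<times> B) = measure R A * measure (?C \<Otimes>\<^sub>M ?C) B"
    if "A \<in> sets R" "B \<in> sets (?C \<Otimes>\<^sub>M ?C)" for A B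
    using that prob_space_R CC.prob_space_axioms by (intro measure_pair_Times)
  have UC: "measure ?C UNIV = 1" using C.prob_space by simp
  have UU: "UNIV \<in> sets (?C \<Otimes>\<^sub>M ?C)" "measure (?C \<Otimes>\<^sub>M ?C) UNIV = 1"
    using pair_measureI[OF U U] CC.prob_space by (simp_all add: space_pair_measure)
  have sets: "?E1 \<in> sets ?M" "?E2 \<in> sets ?M" "?E3 \<in> sets ?M"
    using U UU sets_near sets_not_good by auto
  have "measure ?M ?E1 \<le> 16 / 7 * (3 * \<epsilon> T / (q0 - p0))"
    using prob_near[of "3 * \<epsilon> T"] \<epsilon>_pos[of T] UU sets_near by (simp add: CC')
  also have "\<dots> \<le> 16 / 7 * (3 / 64 * \<rho>)"
    using \<epsilon>_T_le p0_less_q0 by (intro mult_left_mono) (auto simp: pos_divide_le_eq)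
  also have "\<dots> \<le> \<rho> / 2" using \<rho>_pos by simp
  finally have E1: "measure ?M ?E1 \<le> \<rho> / 2" .
  have "measure ?C ?B \<le> \<rho> / 4" using prob_not_good[of p] p by (simp add: \<delta>'_def)
  then have E23: "measure ?M ?E2 \<le> \<rho> / 4" "measure ?M ?E3 \<le> \<rho> / 4"
    using U sets_not_good by (simp_all add: CC CC' UC R.prob_space)
  have "measure ?M (?E1 \<union> ?E2 \<union> ?E3) \<le> \<rho>"
    using E1 E23 measure_Un_le[of "?E1 \<union> ?E2" ?M ?E3] measure_Un_le[of ?E1 ?M ?E2] sets by auto
  then have "1 - \<rho> \<le> measure ?M (space ?M - (?E1 \<union> ?E2 \<union> ?E3))"
    using sets by (subst P.prob_compl) auto
  also have "\<dots> \<le> measure ?M ?X"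
  proof (intro P.finite_measure_mono)
    show "space ?M - (?E1 \<union> ?E2 \<union> ?E3) \<subseteq> ?X"
    proof
      fix x assume x: "x \<in> space ?M - (?E1 \<union> ?E2 \<union> ?E3)"
      obtain r S S' where x_eq: "x = (r, S, S')" by (cases x)
      with x have r: "r \<in> space R" and far: "\<bar>r - min p q0\<bar> > 3 * \<epsilon> T" and "good p S" "good p S'"
        by (auto simp: space_pair_measure)
      moreover have "r < q0" using r b_pos by (simp add: space_R)
      ultimately show "x \<in> ?X" using x x_eq by (simp add: verdict_if_good)
    qed
    let ?P = "Pi\<^sub>M UNIV (\<lambda>_. count_space UNIV) \<Otimes>\<^sub>M R"
    have "(\<lambda>x. tester (fst x) (snd x)) \<in> measurable ?P (count_space UNIV)"
      using randomized by (simp add: randomized_coin_algorithm_def case_prod_unfold)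
    then have t: "(\<lambda>x. fst (tester (fst x) (snd x))) \<in> measurable ?P (count_space UNIV)"
      by (rule measurable_compose) simp
    have "(\<lambda>x. (fst (snd x), fst x)) \<in> measurable ?M ?P" "(\<lambda>x. (snd (snd x), fst x)) \<in> measurable ?M ?P"
      by measurable
    from this[THEN measurable_compose, OF t]
    have [measurable]: "(\<lambda>x. fst (tester (fst (snd x)) (fst x))) \<in> measurable ?M (count_space UNIV)"
        "(\<lambda>x. fst (tester (snd (snd x)) (fst x))) \<in> measurable ?M (count_space UNIV)"
      by simp_all
    \<comment> \<open>Equality of verdicts is reduced to comparing each with a constant, which gives
      measurable events.\<close>
    have Accept_iff: "v = v' \<longleftrightarrow> (v = Accept \<longleftrightarrow> v' = Accept)" for v v'
      by (cases v; cases v') auto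
    have "?X = {x \<in> space ?M. fst (tester (fst (snd x)) (fst x)) = fst (tester (snd (snd x)) (fst x))}"
      by auto
    also have "\<dots> = {x \<in> space ?M. fst (tester (fst (snd x)) (fst x)) = Accept \<longleftrightarrow>
        fst (tester (snd (snd x)) (fst x)) = Accept}"
      by (intro Collect_cong conj_cong refl Accept_iff)
    also have "\<dots> \<in> sets ?M" by measurable
    finally show "?X \<in> sets ?M" .
  qed
  finally show "1 - \<rho> \<le> measure ?M ?X" .
qed

section \<open>Sample complexity\<close>

lemma samples_le:
  "snd (tester S r) \<le> m 1 + (\<Sum>s\<in>{1..<T}. m (Suc s) * of_bool (\<bar>p_hat s S - r\<bar> \<le> 2 * \<epsilon> s))"
  using tester_loop_samples[of 1 S r "T - 1"] T_ge N_Suc[of 1]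
  by (simp add: rAdaptiveCoinTester_eq N_def del: tester_loop.simps sum_mult_of_bool_eq)

text \<open>All batches together form a geometric sum of at most \<open>2 * K * 4 ^ T\<close>; with
  \<open>2 ^ T \<le> 32 / \<rho>\<close> the constant is \<open>2 * 32 ^ 2 = 2048\<close>.\<close>

lemma worst_case: "worst_case_samples R tester \<le> ennreal (2048 * K / \<rho>\<^sup>2)"
  unfolding worst_case_samples_def
proof (intro SUP_least, clarify)
  fix S r
  have "snd (tester S r) \<le> m 1 + (\<Sum>s\<in>{1..<T}. m (Suc s))"
    using samples_le[of S r]
    by (rule order_trans) (intro add_left_mono sum_mono, simp)
  also have "\<dots> = (\<Sum>s<T. m (Suc s))"
    using T_ge by (simp add: sum.atLeast_Suc_lessThan[of 0 T] flip: atLeast0LessThan)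
  finally have "real (snd (tester S r)) \<le> real (\<Sum>s<T. m (Suc s))"
    by (rule of_nat_mono)
  also have "\<dots> \<le> (\<Sum>s<T. K * 4 ^ Suc s)"
    unfolding of_nat_sum by (intro sum_mono m_le)
  also have "\<dots> = K * (\<Sum>s<T. 4 ^ Suc s)" by (simp add: sum_distrib_left)
  also have "\<dots> \<le> K * (2 * (2 ^ T)\<^sup>2)"
    using K_pos sum_power_four_le[of T]
    by (intro mult_left_mono) (auto simp: power2_eq_square simp flip: power_mult_distrib)
  also have "\<dots> \<le> K * (2 * (32 / \<rho>)\<^sup>2)"
    using K_pos two_power_T_le by (intro mult_left_mono power_mono) auto
  finally show "of_nat (snd (tester S r)) \<le> ennreal (2048 * K / \<rho>\<^sup>2)"
    by (simp add: power_divide ennreal_of_nat_eq_real_of_nat mult.commute ennreal_leI)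
qed

text \<open>Close thresholds contribute terms \<open>8 * K * 2 ^ s\<close>, in total at most
  \<open>256 * K / \<rho>\<close>. Inaccurate batches contribute at most
  \<open>K * 4 ^ T * \<delta>'\<close>, which \<open>\<delta>' \<le> \<rho> / 4\<close> brings down
  to \<open>256 * K / \<rho>\<close>. The first batch adds \<open>4 * K / \<rho>\<close>.\<close>

lemma expected:
  assumes p: "0 \<le> p" "p \<le> 1"
  shows "expected_samples R tester p \<le> ennreal (516 * K / \<rho>)"
proof -
  interpret C: prob_space "coin_flips p" by (rule prob_space_coin_flips)
  interpret R: prob_space R by (rule prob_space_R)
  interpret P: pair_prob_space "coin_flips p" R ..
  let ?M = "coin_flips p \<Otimes>\<^sub>M R"
  let ?B = "\<lambda>t. {S. \<not> accurate q0 p (\<epsilon> t) (p_hat t S)}"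
  let ?W = "\<lambda>t. {r\<in>space R. \<bar>r - min p q0\<bar> \<le> 3 * \<epsilon> t}"
  let ?E = "\<lambda>t. ?B t \<times> space R" and ?F = "\<lambda>t. UNIV \<times> ?W t"
  have U: "UNIV \<in> sets (coin_flips p)" using sets.top[of "coin_flips p"] by simp
  have [measurable]: "?E t \<in> sets ?M" "?F t \<in> sets ?M" for t
    using U sets_not_accurate sets_near by auto
  have "expected_samples R tester p \<le>
    (\<integral>\<^sup>+ x. ennreal (m 1) + (\<Sum>s\<in>{1..<T}. ennreal (m (Suc s)) * (indicator (?E s) x + indicator (?F s) x)) \<partial>?M)"
    unfolding expected_samples_def
  proof (intro nn_integral_mono, clarify)
    fix S r assume "(S, r) \<in> space ?M"
    then have r: "r \<in> space R" "r < q0" using b_pos by (auto simp: space_pair_measure space_R)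
    have "snd (tester S r) \<le> m 1 + (\<Sum>s\<in>{1..<T}. m (Suc s) * of_bool (\<bar>p_hat s S - r\<bar> \<le> 2 * \<epsilon> s))"
      by (rule samples_le)
    then have "(of_nat (snd (tester S r)) :: ennreal) \<le>
        of_nat (m 1 + (\<Sum>s\<in>{1..<T}. m (Suc s) * of_bool (\<bar>p_hat s S - r\<bar> \<le> 2 * \<epsilon> s)))"
      by (rule of_nat_mono)
    also have "\<dots> = ennreal (m 1) + (\<Sum>s\<in>{1..<T}. ennreal (m (Suc s)) * of_bool (\<bar>p_hat s S - r\<bar> \<le> 2 * \<epsilon> s))"
      by (simp add: ennreal_of_nat_eq_real_of_nat[symmetric] del: sum_mult_of_bool_eq)
    \<comment> \<open>By \<open>good_undecided\<close> an undecided iteration has an inaccurate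
      batch or a close threshold; adding the indicators is a union bound.\<close>
    also have "\<dots> \<le> ennreal (m 1) + (\<Sum>s\<in>{1..<T}. ennreal (m (Suc s)) * (indicator (?E s) (S, r) + indicator (?F s) (S, r)))"
      using r good_undecided[of p _ S r]
      by (intro add_left_mono sum_mono mult_left_mono) (auto simp: indicator_def)
    finally show "of_nat (snd (tester S r)) \<le> ennreal (m 1) +
        (\<Sum>s\<in>{1..<T}. ennreal (m (Suc s)) * (indicator (?E s) (S, r) + indicator (?F s) (S, r)))" .
  qed
  also have "\<dots> = ennreal (m 1) + (\<Sum>s\<in>{1..<T}. ennreal (m (Suc s)) * (emeasure ?M (?E s) + emeasure ?M (?F s)))"
    by (simp add: nn_integral_add nn_integral_sum nn_integral_cmult P.emeasure_space_1)
  also have "\<dots> = ennreal (m 1) + (\<Sum>s\<in>{1..<T}. ennreal (m (Suc s) * (measure (coin_flips p) (?B s) + measure R (?W s))))"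
  proof -
    have "emeasure ?M (?E s) = ennreal (measure (coin_flips p) (?B s))" for s
      using sets_not_accurate prob_space_R prob_space_coin_flips
      by (simp add: P.emeasure_eq_measure measure_pair_Times R.prob_space)
    moreover have "emeasure ?M (?F s) = ennreal (measure R (?W s))" for s
      using U sets_near prob_space_R prob_space_coin_flips C.prob_space
      by (simp add: P.emeasure_eq_measure measure_pair_Times)
    ultimately show ?thesis
      by (simp add: ennreal_mult flip: ennreal_plus)
  qed
  also have "\<dots> = ennreal (m 1 + (\<Sum>s\<in>{1..<T}. m (Suc s) * (measure (coin_flips p) (?B s) + measure R (?W s))))"
    by (simp add: sum_nonneg)
  also have "\<dots> \<le> ennreal (516 * K / \<rho>)"
  proof (rule ennreal_leI)
    have "(\<Sum>s\<in>{1..<T}. m (Suc s) * (measure (coin_flips p) (?B s) + measure R (?W s)))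
        \<le> (\<Sum>s\<in>{1..<T}. K * (2 ^ T)\<^sup>2 * (\<delta>' / T) + 8 * K * 2 ^ s)"
    proof (rule sum_mono)
      fix s assume s: "s \<in> {1..<T}"
      have B: "measure (coin_flips p) (?B s) \<le> \<delta>' / T"
        using prob_not_accurate_less[of p s] p s by simp
      have "measure R (?W s) \<le> 16 / 7 * (3 * \<epsilon> s / (q0 - p0))"
        using \<epsilon>_pos[of s] by (intro prob_near) simp
      \<comment> \<open>The exact factor \<open>16 / 7 * 3 / 4 = 12 / 7\<close> is rounded up to
        2.\<close>
      also have "\<dots> \<le> 2 / 2 ^ s"
      proof -
        have eq: "3 * \<epsilon> s / (q0 - p0) = 3 / 4 / 2 ^ s" using p0_less_q0 by (simp add: \<epsilon>_def accuracy_def field_simps)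
        show ?thesis unfolding eq by (simp add: field_simps)
      qed
      finally have W: "measure R (?W s) \<le> 2 / 2 ^ s" .
      have "4 ^ Suc s \<le> (4::real) ^ T" using s by (intro power_increasing) auto
      also have "\<dots> = (2 ^ T)\<^sup>2" by (simp add: power2_eq_square flip: power_mult_distrib)
      finally have 4: "4 ^ Suc s \<le> ((2::real) ^ T)\<^sup>2" .
      have "m (Suc s) * (measure (coin_flips p) (?B s) + measure R (?W s))
          \<le> K * 4 ^ Suc s * (\<delta>' / T + 2 / 2 ^ s)"
        using B W m_le[of "Suc s"] K_pos by (intro mult_mono add_mono) auto
      also have "\<dots> = K * 4 ^ Suc s * (\<delta>' / T) + 8 * K * 2 ^ s"
        by (simp add: distrib_left field_simps flip: power_mult_distrib)
      \<comment> \<open>Only the inaccuracy term is enlarged to the last batch size: being constant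
        in \<open>s\<close>, its \<open>T\<close> copies cancel the \<open>1 / T\<close>.\<close>
      also have "\<dots> \<le> K * (2 ^ T)\<^sup>2 * (\<delta>' / T) + 8 * K * 2 ^ s"
        using 4 K_pos \<delta>'_pos by (intro add_right_mono mult_right_mono mult_left_mono) auto
      finally show "m (Suc s) * (measure (coin_flips p) (?B s) + measure R (?W s))
          \<le> K * (2 ^ T)\<^sup>2 * (\<delta>' / T) + 8 * K * 2 ^ s" .
    qed
    also have "\<dots> \<le> (\<Sum>s<T. K * (2 ^ T)\<^sup>2 * (\<delta>' / T) + 8 * K * 2 ^ s)"
      using K_pos \<delta>'_pos by (intro sum_mono2) auto
    also have "\<dots> = K * ((2 ^ T)\<^sup>2 * \<delta>') + 8 * K * (\<Sum>s<T. 2 ^ s)"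
      using T_ge by (simp add: sum.distrib sum_distrib_left)
    also have "\<dots> \<le> K * ((32 / \<rho>)\<^sup>2 * (\<rho> / 4)) + 8 * K * (32 / \<rho>)"
      using K_pos two_power_T_le \<delta>'_pos order_trans[OF sum_power_two_le two_power_T_le]
      by (intro add_mono mult_left_mono mult_mono power_mono) (auto simp: \<delta>'_def)
    also have "\<dots> = 512 * K / \<rho>" using \<rho>_pos by (simp add: field_simps power2_eq_square)
    finally have "(\<Sum>s\<in>{1..<T}. m (Suc s) * (measure (coin_flips p) (?B s) + measure R (?W s))) \<le> 512 * K / \<rho>" .
    moreover have "real (m 1) \<le> 4 * K / \<rho>"
    proof -
      have "real (m 1) \<le> 4 * K" using m_le[of 1] by simp
      also have "\<dots> \<le> 4 * K / \<rho>"
        using \<rho>_pos \<rho>_le_1 K_pos by (simp add: le_divide_eq mult_left_le)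
      finally show ?thesis .
    qed
    ultimately show "m 1 + (\<Sum>s\<in>{1..<T}. m (Suc s) * (measure (coin_flips p) (?B s) + measure R (?W s)))
        \<le> 516 * K / \<rho>" by (simp add: add_divide_distrib[symmetric])
  qed
  finally show ?thesis .
qed

end

theorem theorem3p5:
  "\<exists>C_exp>0. \<exists>C_max>0. \<forall>(p0::real) (q0::real) (\<rho>::real) (\<delta>::real).
     0 \<le> p0 \<longrightarrow> p0 < q0 \<longrightarrow> q0 \<le> 1 \<longrightarrow> 0 < \<delta> \<longrightarrow> \<delta> < \<rho> \<longrightarrow> \<rho> \<le> 1 \<longrightarrow> \<delta> < 1 / 2 \<longrightarrow>
     (let R = threshold_measure p0 q0 \<rho>;
          A = rAdaptiveCoinTester p0 q0 \<rho> \<delta>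
      in randomized_coin_algorithm R A
         \<and> replicable \<rho> R A
         \<and> solves_coin_problem p0 q0 \<delta> R A
         \<and> (\<forall>p\<in>{0..1}. expected_samples R A p
                \<le> ennreal (C_exp * (q0 * ln (1 / \<delta>) / ((q0 - p0)\<^sup>2 * \<rho>))))
         \<and> worst_case_samples R A
                \<le> ennreal (C_max * (q0 * ln (1 / \<delta>) / ((q0 - p0)\<^sup>2 * \<rho>\<^sup>2))))"
proof (rule exI[of _ "516 * 1152"], rule conjI, simp, rule exI[of _ "2048 * 1152"], rule conjI, simp, intro allI impI)
  fix p0 q0 \<rho> \<delta> :: real
  assume "0 \<le> p0" "p0 < q0" "q0 \<le> 1" "0 < \<delta>" "\<delta> < \<rho>" "\<rho> \<le> 1" "\<delta> < 1 / 2"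
  then interpret adaptive_tester p0 q0 \<rho> \<delta>
    by (rule adaptive_tester.intro)
  \<comment> \<open>The factor 1152 inside \<open>K\<close> moves into the absolute
    constants.\<close>
  have "516 * K / \<rho> = 516 * 1152 * (q0 * ln (1 / \<delta>) / ((q0 - p0)\<^sup>2 * \<rho>))"
    "2048 * K / \<rho>\<^sup>2 = 2048 * 1152 * (q0 * ln (1 / \<delta>) / ((q0 - p0)\<^sup>2 * \<rho>\<^sup>2))"
    by (simp_all add: K_def)
  then show "let R = threshold_measure p0 q0 \<rho>;
          A = rAdaptiveCoinTester p0 q0 \<rho> \<delta>
      in randomized_coin_algorithm R A
         \<and> replicable \<rho> R A
         \<and> solves_coin_problem p0 q0 \<delta> R A
         \<and> (\<forall>p\<in>{0..1}. expected_samples R A p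
                \<le> ennreal (516 * 1152 * (q0 * ln (1 / \<delta>) / ((q0 - p0)\<^sup>2 * \<rho>))))
         \<and> worst_case_samples R A
                \<le> ennreal (2048 * 1152 * (q0 * ln (1 / \<delta>) / ((q0 - p0)\<^sup>2 * \<rho>\<^sup>2)))"
    using randomized replicable solves expected worst_case by (simp add: Let_def flip: R_def)
qed

end
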